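(* Let $q$ be a prime power. For all integers $m\geq4$ there exists a non-degenerate minimal $[m+3,3]_{q^m/q}$ code.
   Context: An $[\ell,k]_{q^m/q}$ code (vector rank-metric code) is a $k$-dimensional $\mathbb{F}_{q^m}$-linear subspace $\mathcal{C}\le\mathbb{F}_{q^m}^\ell$, $k\ge1$. For $c\in\mathbb{F}_{q^m}^\ell$ and an ordered basis $\Gamma=(\beta_1,\ldots,\beta_m)$ of $\mathbb{F}_{q^m}$ over $\mathbb{F}_q$, let $\Gamma(c)\in\mathbb{F}_q^{\ell\times m}$ be defined by $c_i=\sum_{j=1}^m\Gamma(c)_{ij}\beta_j$ for all $i$. The rank-support $\sigma^{\mathrm{rk}}(c)\le\mathbb{F}_q^\ell$ of $c$ is the column space of $\Gamma(c)$; it does not depend on $\Gamma$. A codeword $c\in\mathcal{C}$ is minimal if, for every $c'\in\mathcal{C}$, $\sigma^{\mathrm{rk}}(c')\leq\sigma^{\mathrm{rk}}(c)$ implies $c'=\alpha c$ for some $\alpha\in\mathbb{F}_{q^m}$. The code $\mathcal{C}$ is minimal if all its codewords are minimal. The code $\mathcal{C}$ is non-degenerate if the columns of any generator matrix of $\mathcal{C}$ (a $k\times\ell$ matrix over $\mathbb{F}_{q^m}$ whose rows form an $\mathbb{F}_{q^m}$-basis of $\mathcal{C}$) are $\mathbb{F}_q$-linearly independent. *)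

theory Defs
  imports "Jordan_Normal_Form.VS_Connect" "HOL-Library.Cardinality" "HOL-Number_Theory.Prime_Powers"
begin

text \<open>
  The extension of finite fields is given by a field homomorphism \<open>emb\<close> from the
  small field \<open>'a\<close> to the big field \<open>'b\<close>. Vectors of length \<open>n\<close> are the elements of
  \<open>carrier_vec n\<close>.
\<close>

definition ext_space :: "('a::field \<Rightarrow> 'b::field) \<Rightarrow> ('a, 'b) module" where
  "ext_space emb =
    \<lparr>carrier = UNIV, monoid.mult = (*), one = 1, zero = 0, add = (+), module.smult = (\<lambda>a x. emb a * x)\<rparr>"

definition ordered_basis :: "('a::field \<Rightarrow> 'b::field) \<Rightarrow> 'b list \<Rightarrow> bool" where
  "ordered_basis emb \<Gamma> \<longleftrightarrow>
    distinct \<Gamma> \<and> vectorspace.basis class_ring (ext_space emb) (set \<Gamma>)"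

definition is_expansion :: "('a::field \<Rightarrow> 'b::field) \<Rightarrow> 'b list \<Rightarrow> 'b vec \<Rightarrow> 'a mat \<Rightarrow> bool" where
  "is_expansion emb \<Gamma> c A \<longleftrightarrow>
    A \<in> carrier_mat (dim_vec c) (length \<Gamma>) \<and>
    (\<forall>i<dim_vec c. c $ i = (\<Sum>j<length \<Gamma>. emb (A $$ (i, j)) * \<Gamma> ! j))"

definition expansion :: "('a::field \<Rightarrow> 'b::field) \<Rightarrow> 'b list \<Rightarrow> 'b vec \<Rightarrow> 'a mat" where
  "expansion emb \<Gamma> c = (THE A. is_expansion emb \<Gamma> c A)"

text \<open>
  The choice of the basis is immaterial, and a basis exists for finite fields: see
  \<open>rank_support_eq\<close> and \<open>ordered_basis_exists\<close> below.
\<close>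

definition rank_support :: "('a::field \<Rightarrow> 'b::field) \<Rightarrow> 'b vec \<Rightarrow> 'a vec set" where
  "rank_support emb c =
    vec_space.col_space (dim_vec c) (expansion emb (SOME \<Gamma>. ordered_basis emb \<Gamma>) c)"

definition vector_code :: "nat \<Rightarrow> nat \<Rightarrow> 'b::field vec set \<Rightarrow> bool" where
  "vector_code l k C \<longleftrightarrow>
    1 \<le> k \<and>
    VectorSpace.subspace class_ring C (module_vec TYPE('b) l) \<and>
    vectorspace.dim class_ring (module_vec TYPE('b) l\<lparr>carrier := C\<rparr>) = k"

definition minimal_codeword :: "('a::field \<Rightarrow> 'b::field) \<Rightarrow> 'b vec set \<Rightarrow> 'b vec \<Rightarrow> bool" where
  "minimal_codeword emb C c \<longleftrightarrow>
    c \<in> C \<and>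
    (\<forall>c'\<in>C. rank_support emb c' \<subseteq> rank_support emb c \<longrightarrow> (\<exists>\<alpha>. c' = \<alpha> \<cdot>\<^sub>v c))"

definition minimal_code :: "('a::field \<Rightarrow> 'b::field) \<Rightarrow> 'b vec set \<Rightarrow> bool" where
  "minimal_code emb C \<longleftrightarrow> (\<forall>c\<in>C. minimal_codeword emb C c)"

definition generator_matrix :: "nat \<Rightarrow> nat \<Rightarrow> 'b::field vec set \<Rightarrow> 'b mat \<Rightarrow> bool" where
  "generator_matrix l k C G \<longleftrightarrow>
    G \<in> carrier_mat k l \<and> distinct (rows G) \<and>
    vectorspace.basis class_ring (module_vec TYPE('b) l\<lparr>carrier := C\<rparr>) (set (rows G))"

text \<open>
  \<open>G *\<^sub>v map_vec emb x\<close> is the combination of the columns of \<open>G\<close> with the coefficients \<open>x\<close>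
  from the small field. Independence is that of the family of columns, so a repeated
  column counts as a dependence.
\<close>

definition columns_independent :: "('a::field \<Rightarrow> 'b::field) \<Rightarrow> 'b mat \<Rightarrow> bool" where
  "columns_independent emb G \<longleftrightarrow>
    (\<forall>x\<in>carrier_vec (dim_col G).
      G *\<^sub>v map_vec emb x = 0\<^sub>v (dim_row G) \<longrightarrow> x = 0\<^sub>v (dim_col G))"

definition nondegenerate ::
    "('a::field \<Rightarrow> 'b::field) \<Rightarrow> nat \<Rightarrow> nat \<Rightarrow> 'b vec set \<Rightarrow> bool" where
  "nondegenerate emb l k C \<longleftrightarrow> (\<forall>G. generator_matrix l k C G \<longrightarrow> columns_independent emb G)"


lemma ext_space_vectorspace:
  assumes "field_hom emb"
  shows "vectorspace class_ring (ext_space emb)"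
proof -
  interpret field_hom emb by fact
  have 1: "field (class_ring :: 'a ring)" by (rule class_field)
  have cr: "cring (class_ring :: 'a ring)" by unfold_locales
  have ab: "abelian_group (ext_space emb)"
    by (rule abelian_groupI) (auto simp: ext_space_def intro: exI[of _ "- x" for x])
  have "Module.module class_ring (ext_space emb)"
    by (rule moduleI[OF cr ab]) (auto simp: ext_space_def hom_distribs algebra_simps)
  then show ?thesis using 1 by (simp add: vectorspace_def)
qed

lemma ext_space_finsum:
  "finsum (ext_space emb) f S = sum f S" if "field_hom emb"
proof -
  interpret vectorspace class_ring "ext_space emb" by (rule ext_space_vectorspace) fact
  have z: "\<zero>\<^bsub>ext_space emb\<^esub> = 0" by (simp add: ext_space_def)
  show ?thesis
  proof (induct S rule: infinite_finite_induct)
    case (insert x F)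
    then show ?case by (subst finsum_insert) (auto simp: ext_space_def)
  qed (simp_all add: z)
qed

lemma ordered_basis_exists:
  fixes emb :: "'a::field \<Rightarrow> 'b::{field,finite}"
  assumes "field_hom emb"
  shows "\<exists>\<Gamma>. ordered_basis emb \<Gamma>"
proof -
  interpret vectorspace class_ring "ext_space emb" by (rule ext_space_vectorspace) fact
  have c: "carrier (ext_space emb) = UNIV" by (simp add: ext_space_def)
  have "UNIV \<subseteq> span UNIV" using in_own_span[of UNIV] c by auto
  then have "fin_dim" unfolding fin_dim_def using c by (intro exI[of _ UNIV]) auto
  then obtain B where "finite B" "basis B" using finite_basis_exists by blast
  then show ?thesis using finite_distinct_list[of B] unfolding ordered_basis_def by blast
qed

lemma ordered_basis_unique_coords:
  assumes hom: "field_hom emb" and B: "ordered_basis emb \<Gamma>"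
  shows "\<exists>a. x = (\<Sum>j<length \<Gamma>. emb (a j) * \<Gamma> ! j)"
    and "(\<Sum>j<length \<Gamma>. emb (a j) * \<Gamma> ! j) = (\<Sum>j<length \<Gamma>. emb (b j) * \<Gamma> ! j)
      \<Longrightarrow> j < length \<Gamma> \<Longrightarrow> a j = b j"
proof -
  interpret field_hom emb by fact
  interpret vectorspace class_ring "ext_space emb" by (rule ext_space_vectorspace) fact
  have c: "carrier (ext_space emb) = UNIV" by (simp add: ext_space_def)
  have d: "distinct \<Gamma>" and b: "lin_indpt (set \<Gamma>)" "span (set \<Gamma>) = UNIV"
    using B unfolding ordered_basis_def basis_def c by auto
  have bij: "bij_betw ((!) \<Gamma>) {..<length \<Gamma>} (set \<Gamma>)" by (rule bij_betw_nth[OF d]) auto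
  have lc: "lincomb f S = (\<Sum>v\<in>S. emb (f v) * v)" for f S
    unfolding lincomb_def ext_space_finsum[OF hom] by (simp add: ext_space_def)
  show "\<exists>a. x = (\<Sum>j<length \<Gamma>. emb (a j) * \<Gamma> ! j)"
  proof -
    have "x \<in> span (set \<Gamma>)" using b(2) by auto
    then obtain f where "x = lincomb f (set \<Gamma>)"
      using finite_span[of "set \<Gamma>"] c by auto
    then have "x = (\<Sum>j<length \<Gamma>. emb (f (\<Gamma> ! j)) * \<Gamma> ! j)"
      unfolding lc by (simp add: sum.reindex_bij_betw[OF bij, symmetric])
    then show ?thesis by (rule exI[of _ "\<lambda>j. f (\<Gamma> ! j)"])
  qed
  assume eq: "(\<Sum>j<length \<Gamma>. emb (a j) * \<Gamma> ! j) = (\<Sum>j<length \<Gamma>. emb (b j) * \<Gamma> ! j)"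
    and j: "j < length \<Gamma>"
  define g where "g v = (let i = inv_into {..<length \<Gamma>} ((!) \<Gamma>) v in a i - b i)" for v
  have g: "g (\<Gamma> ! i) = a i - b i" if "i < length \<Gamma>" for i
    using that bij inv_into_f_f[of "(!) \<Gamma>" "{..<length \<Gamma>}" i] unfolding g_def bij_betw_def
    by (auto simp: Let_def)
  have "lincomb g (set \<Gamma>) = (\<Sum>j<length \<Gamma>. emb (a j - b j) * \<Gamma> ! j)"
    unfolding lc sum.reindex_bij_betw[OF bij, symmetric] by (intro sum.cong) (auto simp: g)
  also have "\<dots> = 0" using eq by (simp add: hom_distribs left_diff_distrib sum_subtractf)
  finally have z: "lincomb g (set \<Gamma>) = \<zero>\<^bsub>ext_space emb\<^esub>" by (simp add: ext_space_def)
  have "g (\<Gamma> ! j) = 0"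
  proof (rule ccontr)
    assume "g (\<Gamma> ! j) \<noteq> 0"
    then have "lin_dep (set \<Gamma>)" unfolding lin_dep_def
      using j z by (intro exI[of _ "set \<Gamma>"] exI[of _ g] exI[of _ "\<Gamma> ! j"]) auto
    then show False using b by blast
  qed
  then show "a j = b j" using g[OF j] by simp
qed

lemma is_expansion_ex1:
  assumes "field_hom emb" "ordered_basis emb \<Gamma>"
  shows "\<exists>!A. is_expansion emb \<Gamma> c A"
proof -
  note u = ordered_basis_unique_coords[OF assms]
  obtain a where a: "\<And>x. x = (\<Sum>j<length \<Gamma>. emb (a x j) * \<Gamma> ! j)" using u(1) by metis
  show ?thesis
  proof (rule ex1I)
    show "is_expansion emb \<Gamma> c (mat (dim_vec c) (length \<Gamma>) (\<lambda>(i,j). a (c $ i) j))"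
      unfolding is_expansion_def using a by auto
    fix A assume A: "is_expansion emb \<Gamma> c A"
    show "A = mat (dim_vec c) (length \<Gamma>) (\<lambda>(i,j). a (c $ i) j)"
    proof (rule eq_matI)
      fix i j assume ij: "i < dim_row (mat (dim_vec c) (length \<Gamma>) (\<lambda>(i,j). a (c $ i) j))"
        "j < dim_col (mat (dim_vec c) (length \<Gamma>) (\<lambda>(i,j). a (c $ i) j))"
      have "(\<Sum>j<length \<Gamma>. emb (A $$ (i, j)) * \<Gamma> ! j) =
          (\<Sum>j<length \<Gamma>. emb (a (c $ i) j) * \<Gamma> ! j)"
        using A ij a[of "c $ i"] unfolding is_expansion_def by auto
      from u(2)[OF this] ij show "A $$ (i, j) =
          mat (dim_vec c) (length \<Gamma>) (\<lambda>(i,j). a (c $ i) j) $$ (i, j)" by auto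
    qed (use A in \<open>auto simp: is_expansion_def\<close>)
  qed
qed

lemma expansion_works:
  assumes "field_hom emb" "ordered_basis emb \<Gamma>"
  shows "is_expansion emb \<Gamma> c (expansion emb \<Gamma> c)"
  unfolding expansion_def by (rule theI'[OF is_expansion_ex1[OF assms]])

lemma col_space_expansion_mono:
  fixes emb :: "'a::field \<Rightarrow> 'b::field"
  assumes hom: "field_hom emb" and B: "ordered_basis emb \<Gamma>" "ordered_basis emb \<Delta>"
  shows "vec_space.col_space (dim_vec c) (expansion emb \<Gamma> c)
    \<subseteq> vec_space.col_space (dim_vec c) (expansion emb \<Delta> c)"
proof -
  interpret field_hom emb by fact
  let ?n = "dim_vec c"
  define A where "A = expansion emb \<Gamma> c"
  define D where "D = expansion emb \<Delta> c"
  have A: "is_expansion emb \<Gamma> c A" and D: "is_expansion emb \<Delta> c D"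
    unfolding A_def D_def using expansion_works hom B by auto
  obtain t where t: "\<And>x. x = (\<Sum>j<length \<Gamma>. emb (t x j) * \<Gamma> ! j)"
    using ordered_basis_unique_coords(1)[OF hom B(1)] by metis
  define T where "T = mat (length \<Delta>) (length \<Gamma>) (\<lambda>(k,j). t (\<Delta> ! k) j)"
  have cA: "A \<in> carrier_mat ?n (length \<Gamma>)" and cD: "D \<in> carrier_mat ?n (length \<Delta>)"
    and cT: "T \<in> carrier_mat (length \<Delta>) (length \<Gamma>)"
    using A D unfolding is_expansion_def T_def by auto
  have "is_expansion emb \<Gamma> c (D * T)"
    unfolding is_expansion_def
  proof (intro conjI allI impI)
    show "D * T \<in> carrier_mat ?n (length \<Gamma>)" using cD cT by auto
    fix i assume i: "i < ?n"
    have "c $ i = (\<Sum>k<length \<Delta>. emb (D $$ (i, k)) * \<Delta> ! k)"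
      using D i unfolding is_expansion_def by auto
    also have "\<dots> = (\<Sum>k<length \<Delta>. \<Sum>j<length \<Gamma>.
        emb (D $$ (i, k)) * (emb (t (\<Delta> ! k) j) * \<Gamma> ! j))"
      by (subst t) (simp add: sum_distrib_left)
    also have "\<dots> = (\<Sum>j<length \<Gamma>. \<Sum>k<length \<Delta>.
        emb (D $$ (i, k)) * (emb (t (\<Delta> ! k) j) * \<Gamma> ! j))"
      by (rule sum.swap)
    also have "\<dots> = (\<Sum>j<length \<Gamma>. emb ((D * T) $$ (i, j)) * \<Gamma> ! j)"
    proof (rule sum.cong[OF refl])
      fix j assume "j \<in> {..<length \<Gamma>}"
      then have "(D * T) $$ (i, j) = (\<Sum>k<length \<Delta>. D $$ (i, k) * t (\<Delta> ! k) j)"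
        using cD cT i by (auto simp: T_def scalar_prod_def lessThan_atLeast0)
      then show "(\<Sum>k<length \<Delta>. emb (D $$ (i, k)) * (emb (t (\<Delta> ! k) j) * \<Gamma> ! j)) =
          emb ((D * T) $$ (i, j)) * \<Gamma> ! j"
        by (simp add: hom_distribs sum_distrib_right mult.assoc)
    qed
    finally show "c $ i = (\<Sum>j<length \<Gamma>. emb ((D * T) $$ (i, j)) * \<Gamma> ! j)" .
  qed
  then have AD: "A = D * T" using is_expansion_ex1[OF hom B(1)] A by blast
  show ?thesis
    unfolding A_def[symmetric] D_def[symmetric]
      vec_space.col_space_eq[OF cA] vec_space.col_space_eq[OF cD]
  proof clarify
    fix x :: "'a vec" assume x: "x \<in> carrier_vec (dim_col A)"
    have "A *\<^sub>v x = D *\<^sub>v (T *\<^sub>v x)"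
      unfolding AD by (rule assoc_mult_mat_vec[OF cD cT]) (use x cA in auto)
    then show "A *\<^sub>v x \<in> carrier_vec (dim_row D) \<and> (\<exists>y\<in>carrier_vec (dim_col D). D *\<^sub>v y = A *\<^sub>v x)"
      using cD mult_mat_vec_carrier[OF cT, of x] x cA by auto
  qed
qed

lemma rank_support_eq:
  assumes "field_hom emb" "ordered_basis emb \<Gamma>"
  shows "rank_support emb c = vec_space.col_space (dim_vec c) (expansion emb \<Gamma> c)"
  unfolding rank_support_def
  using col_space_expansion_mono[OF assms(1)] assms(2) someI[of "ordered_basis emb", OF assms(2)]
  by blast

end

theory Submission
  imports Defs "HOL-Library.Product_Plus" "Jordan_Normal_Form.DL_Rank"
begin

text \<open>
  A 3-dimensional code is the set of vectors \<open>(a \<bullet> u\<^sub>i)\<^sub>i\<close>, \<open>a \<in> F\<^sup>3\<close>, for some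
  \<open>u\<^sub>i \<in> F\<^sup>3\<close>, where \<open>F\<close> is the big field. It is minimal as soon as, for each
  \<open>a \<noteq> 0\<close>, the span \<open>U\<close> of the \<open>u\<^sub>i\<close> over the small field meets \<open>a\<^sup>\<bottom>\<close> in two
  \<open>F\<close>-independent vectors. If \<open>dim U = m + 3\<close>, then \<open>dim (U \<inter> a\<^sup>\<bottom>) \<ge> 3\<close>, so it suffices that
  \<open>U\<close> meets every point (1-dimensional \<open>F\<close>-subspace) in dimension at most 2.

  Such a \<open>U\<close> is built greedily. If all weights (the dimensions of \<open>U \<inter> P\<close> for the points \<open>P\<close>)
  are at most \<open>t + 1\<close>, then adjoining a vector outside all \<open>U + P\<close>, for the points \<open>P\<close> of
  weight \<open>t + 1\<close>, keeps this bound. Counting shows that such vectors exist up to dimension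
  \<open>m + 1\<close> with \<open>t = 0\<close>. Adjoining any further vector gives weights at most 2, with so few points
  of weight 2 that one more vector can be adjoined with \<open>t = 1\<close>.
\<close>

section \<open>Counting in finite vector spaces\<close>

text \<open>Each nonempty fibre of \<open>f\<close> on \<open>S\<close> is a translate of the
  kernel.\<close>

lemma card_eq_image_times_kernel:
  fixes f :: "'x::ab_group_add \<Rightarrow> 'y::ab_group_add"
  assumes S: "finite S" "0 \<in> S" "\<And>x y. x \<in> S \<Longrightarrow> y \<in> S \<Longrightarrow> x - y \<in> S"
    and f: "\<And>x y. x \<in> S \<Longrightarrow> y \<in> S \<Longrightarrow> f (x - y) = f x - f y"
  shows "card S = card (f ` S) * card {x \<in> S. f x = 0}"
proof -
  let ?K = "{x \<in> S. f x = 0}"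
  have fib: "card {x \<in> S. f x = y} = card ?K" if y: "y \<in> f ` S" for y
  proof -
    obtain x0 where x0: "x0 \<in> S" "y = f x0" using y by auto
    have neg: "- x \<in> S" if "x \<in> S" for x using S(3)[OF S(2) that] by simp
    have add: "x + y \<in> S" if "x \<in> S" "y \<in> S" for x y using S(3)[OF that(1) neg[OF that(2)]] by simp
    have fadd: "f (x + x0) = f x + f x0" if "x \<in> S" for x
      using f[OF add[OF that x0(1)] x0(1)] by (simp add: algebra_simps)
    have "bij_betw (\<lambda>x. x + x0) ?K {x \<in> S. f x = y}"
      by (rule bij_betwI[where g = "\<lambda>x. x - x0"]) (auto simp: x0 add S f fadd)
    then show ?thesis using bij_betw_same_card by fastforce
  qed
  have "card S = (\<Sum>y\<in>f ` S. card {x \<in> S. f x = y})"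
    using sum.group[OF S(1), of "f ` S" f "\<lambda>_. 1 :: nat"] S(1) by (simp only: card_eq_sum) simp
  then show ?thesis by (simp add: fib)
qed

context vector_space
begin

text \<open>Vectors of the larger span are uniquely \<open>k *s v + y\<close> with \<open>y\<close>
  in the old one: two different \<open>k\<close> would put \<open>v\<close> into
  \<open>span B\<close>.\<close>

lemma card_span_insert:
  assumes "finite (UNIV :: 'a set)" "v \<notin> span B"
  shows "card (span (insert v B)) = CARD('a) * card (span B)"
proof -
  have "span (insert v B) = (\<lambda>(k, y). k *s v + y) ` (UNIV \<times> span B)"
    unfolding span_insert
  proof (intro subset_antisym subsetI)
    fix x assume "x \<in> {x. \<exists>k. x - k *s v \<in> span B}"
    then obtain k where "x - k *s v \<in> span B" by blast
    then show "x \<in> (\<lambda>(k, y). k *s v + y) ` (UNIV \<times> span B)"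
      by (intro image_eqI[of _ _ "(k, x - k *s v)"]) auto
  next
    fix x assume "x \<in> (\<lambda>(k, y). k *s v + y) ` (UNIV \<times> span B)"
    then obtain k y where "x = k *s v + y" "y \<in> span B" by auto
    then show "x \<in> {x. \<exists>k. x - k *s v \<in> span B}" by (auto intro!: exI[of _ k])
  qed
  moreover have "inj_on (\<lambda>(k, y). k *s v + y) (UNIV \<times> span B)"
  proof (rule inj_onI; clarsimp)
    fix k y l z assume y: "y \<in> span B" and z: "z \<in> span B" and eq: "k *s v + y = l *s v + z"
    have e: "(k - l) *s v = z - y" using eq by (simp add: scale_left_diff_distrib algebra_simps)
    have "k = l"
    proof (rule ccontr)
      assume "k \<noteq> l"
      then have "v = inverse (k - l) *s (z - y)" by (simp flip: e)
      then show False using assms(2) span_scale span_diff[OF z y] by metis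
    qed
    then show "k = l \<and> y = z" using eq by simp
  qed
  ultimately show ?thesis by (simp add: card_image card_cartesian_product)
qed

lemma card_span:
  assumes "finite (UNIV :: 'a set)" "finite B" "independent B"
  shows "card (span B) = CARD('a) ^ card B"
  using assms(2,3)
proof (induction B rule: finite_induct)
  case (insert v B)
  then have "v \<notin> span B" "independent B" by (auto simp: independent_insert)
  then show ?case using insert card_span_insert[OF assms(1)] by simp
qed simp

lemma card_subspace_power:
  assumes "finite (UNIV :: 'a set)" "finite S" "subspace S"
  obtains j where "card S = CARD('a) ^ j"
proof -
  obtain B where B: "B \<subseteq> S" "independent B" "S \<subseteq> span B" by (rule maximal_independent_subset)
  then have "S = span B" using assms(3) by (simp add: span_minimal subset_antisym)
  then show ?thesis using card_span[OF assms(1) finite_subset[OF B(1) assms(2)] B(2)] that by simp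
qed

lemma card_subspace_gt_power:
  assumes "finite (UNIV :: 'a set)" "finite S" "subspace S" "card S > CARD('a) ^ t"
  shows "card S \<ge> CARD('a) ^ Suc t"
proof -
  obtain j where j: "card S = CARD('a) ^ j" using card_subspace_power assms by blast
  have "{0, 1 :: 'a} \<subseteq> UNIV" by simp
  then have "card {0, 1 :: 'a} \<le> CARD('a)" using assms(1) by (rule card_mono[rotated])
  then have c: "1 < CARD('a)" by simp
  then have "j \<ge> Suc t" using assms(4) j power_less_imp_less_exp by fastforce
  then show ?thesis using j c power_increasing[of "Suc t" j "CARD('a)"] by simp
qed

text \<open>The dimension formula for S + T. With differences instead of sums, the kernel on
  \<open>S \<times> T\<close> is the diagonal copy of \<open>S \<inter> T\<close>.\<close>

lemma card_subspace_sum_times_Int: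
  assumes "finite S" "finite T" "subspace S" "subspace T"
  shows "card ((\<lambda>(x, y). x - y) ` (S \<times> T)) * card (S \<inter> T) = card S * card T"
proof -
  have "card (S \<times> T) = card ((\<lambda>(x, y). x - y) ` (S \<times> T)) * card {p \<in> S \<times> T. (\<lambda>(x, y). x - y) p = 0}"
    by (rule card_eq_image_times_kernel)
      (use assms in \<open>auto simp: subspace_0 subspace_diff zero_prod_def\<close>)
  moreover have "{p \<in> S \<times> T. (\<lambda>(x, y). x - y) p = 0} = (\<lambda>x. (x, x)) ` (S \<inter> T)" by auto
  moreover have "card ((\<lambda>x. (x, x)) ` (S \<inter> T)) = card (S \<inter> T)" by (simp add: card_image inj_on_def)
  ultimately show ?thesis by (simp add: card_cartesian_product)
qed

text \<open>For the new intersection X, the sum X + \<open>span B\<close> lies in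
  \<open>span (insert v B)\<close>, and X meets \<open>span B\<close> in
  \<open>span B \<inter> W\<close>; the dimension formula bounds X.\<close>

lemma card_Int_span_insert_le:
  assumes "finite (UNIV :: 'a set)" "finite (span (insert v B))" "subspace W"
  shows "card (span (insert v B) \<inter> W) \<le> CARD('a) * card (span B \<inter> W)"
proof (cases "v \<in> span B")
  case True
  have "{0::'a} \<subseteq> UNIV" by simp
  then have "0 < CARD('a)" using assms(1) card_gt_0_iff by blast
  then show ?thesis using True by (simp add: span_redundant)
next
  case False
  let ?U = "span B" and ?X = "span (insert v B) \<inter> W"
  have sub: "?U \<subseteq> span (insert v B)" by (rule span_mono) auto
  have f: "finite ?U" "finite ?X" using assms(2) sub finite_subset by auto
  have sX: "subspace ?X" using assms(3) by (simp add: subspace_inter)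
  have i: "?X \<inter> ?U = ?U \<inter> W" using sub by auto
  have "card ?X * card ?U = card ((\<lambda>(x, y). x - y) ` (?X \<times> ?U)) * card (?X \<inter> ?U)"
    using card_subspace_sum_times_Int[OF f(2,1) sX] by simp
  also have "\<dots> \<le> card (span (insert v B)) * card (?U \<inter> W)"
    unfolding i using assms(2) sub by (intro mult_le_mono1 card_mono) (auto intro!: span_diff)
  also have "\<dots> = CARD('a) * card (?U \<inter> W) * card ?U"
    using card_span_insert[OF assms(1) False] by simp
  finally show ?thesis using f(1) card_gt_0_iff[of ?U] span_zero by (metis mult_le_cancel2 empty_iff)
qed

lemma Int_span_singleton:
  assumes "span {v} \<noteq> span {w}"
  shows "span {v} \<inter> span {w} = {0}"
proof -
  have "x = 0" if "x \<in> span {v}" "x \<in> span {w}" for x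
  proof (rule ccontr)
    assume "x \<noteq> 0"
    have "span {x} = span {u}" if u: "x \<in> span {u}" for u
    proof -
      obtain c where c: "x = c *s u" using u by (auto simp: span_singleton)
      then have "u = inverse c *s x" using \<open>x \<noteq> 0\<close> by auto
      then have "u \<in> span {x}" by (auto simp: span_singleton)
      then show ?thesis using u by (simp add: span_eq)
    qed
    then show False using that assms by metis
  qed
  then show ?thesis using span_zero by auto
qed

end

section \<open>Greedy construction of subspaces of small weight\<close>

locale extended_vector_space = vector_space scale + field_hom emb
  for scale :: "'b::{field,finite} \<Rightarrow> 'v::{ab_group_add,finite} \<Rightarrow> 'v" (infixr \<open>*s\<close> 75)
    and emb :: "'a::{field,finite} \<Rightarrow> 'b"
begin

text \<open>Restriction of scalars: \<open>span\<close> over the big field yields the points,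
  \<open>sub.span\<close> over the small field the subspaces U.\<close>

sublocale sub: vector_space "\<lambda>a. scale (emb a)"
  by unfold_locales (simp_all add: scale_left_distrib scale_right_distrib hom_distribs)

lemma sub_subspace: "subspace S \<Longrightarrow> sub.subspace S"
  unfolding subspace_def sub.subspace_def by auto

text \<open>Cardinality stands in for dimension: if \<open>U\<close> is a
  \<open>sub.subspace\<close>, the bound says that it meets each point in dimension at most
  \<open>t\<close>.\<close>

definition weight_le :: "'v set \<Rightarrow> nat \<Rightarrow> bool" where
  "weight_le U t \<longleftrightarrow> (\<forall>v. v \<noteq> 0 \<longrightarrow> card (U \<inter> span {v}) \<le> CARD('a) ^ t)"

definition heavy_points :: "'v set \<Rightarrow> nat \<Rightarrow> 'v set set" where
  "heavy_points U t = {P. \<exists>v. v \<noteq> 0 \<and> P = span {v} \<and> CARD('a) ^ t < card (U \<inter> P)}"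

lemma weight_le_span_insert_Suc:
  assumes "weight_le (sub.span B) t"
  shows "weight_le (sub.span (insert v B)) (Suc t)"
  unfolding weight_le_def
proof (intro allI impI)
  fix w :: 'v assume "w \<noteq> 0"
  have "card (sub.span (insert v B) \<inter> span {w}) \<le> CARD('a) * card (sub.span B \<inter> span {w})"
    by (rule sub.card_Int_span_insert_le) (auto intro: sub_subspace)
  also have "\<dots> \<le> CARD('a) * CARD('a) ^ t"
    using assms \<open>w \<noteq> 0\<close> by (simp add: weight_le_def)
  finally show "card (sub.span (insert v B) \<inter> span {w}) \<le> CARD('a) ^ Suc t" by simp
qed

text \<open>Distinct points meet only in \<open>0\<close>, so the sets \<open>U \<inter> P - U'\<close> are disjoint.\<close>

lemma card_heavy_points_le:
  assumes "0 \<in> U'" "0 < k" and k: "\<And>P. P \<in> heavy_points U t \<Longrightarrow> k \<le> card (U \<inter> P - U')"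
    and "card (U - U') \<le> N * k"
  shows "card (heavy_points U t) \<le> N"
proof -
  let ?H = "heavy_points U t"
  have "card ?H * k \<le> (\<Sum>P\<in>?H. card (U \<inter> P - U'))"
    using sum_mono[OF k, of ?H "\<lambda>x. x"] by simp
  also have "\<dots> = card (\<Union>P\<in>?H. U \<inter> P - U')"
  proof (rule card_UN_disjoint[symmetric])
    show "\<forall>P\<in>?H. \<forall>Q\<in>?H. P \<noteq> Q \<longrightarrow> (U \<inter> P - U') \<inter> (U \<inter> Q - U') = {}"
    proof (intro ballI impI)
      fix P Q assume "P \<in> ?H" "Q \<in> ?H" "P \<noteq> Q"
      then have "P \<inter> Q = {0}"
        using Int_span_singleton unfolding heavy_points_def by blast
      moreover have "(U \<inter> P - U') \<inter> (U \<inter> Q - U') \<subseteq> P \<inter> Q - U'" by blast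
      ultimately show "(U \<inter> P - U') \<inter> (U \<inter> Q - U') = {}" using assms(1) by simp
    qed
  qed auto
  also have "\<dots> \<le> card (U - U')" by (rule card_mono) auto
  also have "\<dots> \<le> N * k" by fact
  finally show ?thesis using assms(2) by simp
qed

text \<open>For a heavy P, |U + P| is at most q^(d + m - (t + 1)) \<le> q^(2m), and q^m such sets
  cannot cover all q^(3m) vectors. A vector outside them leaves the intersections with heavy points
  unchanged; any other point has weight at most t and gains at most one.\<close>

lemma exists_extension_same_weight:
  assumes dims: "CARD('b) = CARD('a) ^ m" "CARD('v) = CARD('b) ^ 3"
    and U: "card (sub.span B) = CARD('a) ^ d" "d < 3 * m" "d \<le> m + Suc t"
    and w: "weight_le (sub.span B) (Suc t)"
    and h: "card (heavy_points (sub.span B) t) \<le> CARD('a) ^ m"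
  shows "\<exists>v. v \<notin> sub.span B \<and> weight_le (sub.span (insert v B)) (Suc t)"
proof -
  let ?q = "CARD('a)" and ?U = "sub.span B" and ?H = "heavy_points (sub.span B) t"
  have q: "1 < ?q" using card_mono[of UNIV "{0, 1 :: 'a}"] by simp
  have V: "CARD('v) = ?q ^ (3 * m)" using dims by (simp add: power_mult[symmetric] mult.commute)
  define S where "S P = (\<lambda>(x, y). x - y) ` (?U \<times> P)" for P
  have cS: "card (S P) \<le> ?q ^ (2 * m)" if P_H: "P \<in> ?H" for P
  proof -
    obtain v where v: "v \<noteq> 0" "P = span {v}" "?q ^ t < card (?U \<inter> P)"
      using P_H by (auto simp: heavy_points_def)
    have P: "card P = ?q ^ m" using card_span[of "{v}"] v dims by (simp add: independent_insert)
    have sP: "sub.subspace P" using v by (simp add: sub_subspace)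
    have i: "?q ^ Suc t \<le> card (?U \<inter> P)"
      using sP v(3) by (intro sub.card_subspace_gt_power) (auto intro: sub.subspace_inter)
    have "card (S P) * ?q ^ Suc t \<le> card (S P) * card (?U \<inter> P)" using i by (rule mult_le_mono2)
    also have "\<dots> = ?q ^ (d + m)"
      unfolding S_def using sP by (simp add: sub.card_subspace_sum_times_Int U P power_add)
    also have "\<dots> \<le> ?q ^ (2 * m + Suc t)" using U(3) q by (intro power_increasing) auto
    also have "\<dots> = ?q ^ (2 * m) * ?q ^ Suc t" by (rule power_add)
    finally show ?thesis using q by simp
  qed
  have U_sub: "?U \<subseteq> S P" if "P \<in> ?H" for P
  proof -
    have "0 \<in> P" using that span_zero by (auto simp: heavy_points_def)
    then show ?thesis unfolding S_def by force
  qed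
  have "card (?U \<union> (\<Union>P\<in>?H. S P)) < CARD('v)"
  proof (cases "?H = {}")
    case True
    then show ?thesis using U q V by simp
  next
    case False
    \<comment> \<open>The plain union bound gives q^m * q^(2m) = q^(3m), which is not strict.
      Counting the common vector 0 only once makes it strict.\<close>
    let ?Z = "\<Union>P\<in>?H. S P - {0}"
    have "?U \<union> (\<Union>P\<in>?H. S P) = insert 0 ?Z"
      using U_sub False sub.span_zero[of B] by auto
    moreover have "card (insert 0 ?Z) \<le> Suc (card ?Z)"
      unfolding card_insert_if[OF finite] by simp
    ultimately have "card (?U \<union> (\<Union>P\<in>?H. S P)) \<le> Suc (card ?Z)" by (simp only:)
    also have "\<dots> \<le> Suc (\<Sum>P\<in>?H. card (S P - {0}))" by (intro Suc_le_mono[THEN iffD2] card_UN_le) simp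
    also have "(\<Sum>P\<in>?H. card (S P - {0})) \<le> (\<Sum>P\<in>?H. ?q ^ (2 * m) - 1)"
    proof (rule sum_mono)
      fix P assume P: "P \<in> ?H"
      then have "0 \<in> S P" using U_sub sub.span_zero by blast
      then show "card (S P - {0}) \<le> ?q ^ (2 * m) - 1" using cS[OF P] by simp
    qed
    also have "\<dots> \<le> ?q ^ m * (?q ^ (2 * m) - 1)" using h by simp
    also have "Suc \<dots> = Suc (?q ^ (3 * m) - ?q ^ m)"
      by (simp add: diff_mult_distrib2 power_add[symmetric])
    also have "\<dots> < ?q ^ (3 * m)"
    proof -
      have "0 < m" using U(2) by simp
      then have "1 < ?q ^ m" using q by (intro one_less_power)
      moreover have "?q ^ m \<le> ?q ^ (3 * m)" using q by (intro power_increasing) auto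
      ultimately show ?thesis by linarith
    qed
    finally show ?thesis using V by simp
  qed
  then have "?U \<union> (\<Union>P\<in>?H. S P) \<noteq> UNIV" by force
  then obtain v where "v \<notin> ?U \<union> (\<Union>P\<in>?H. S P)" by blast
  then have v: "v \<notin> ?U" "\<And>P. P \<in> ?H \<Longrightarrow> v \<notin> S P" by auto
  have "card (sub.span (insert v B) \<inter> span {w}) \<le> ?q ^ Suc t" if "w \<noteq> 0" for w
  proof (cases "span {w} \<in> ?H")
    case True
    have "x \<in> ?U" if xs: "x \<in> sub.span (insert v B)" "x \<in> span {w}" for x
    proof (rule ccontr)
      assume x: "x \<notin> ?U"
      obtain k where k: "x - emb k *s v \<in> ?U" using xs(1) by (auto simp: sub.span_insert)
      have "k \<noteq> 0" using k x by auto
      \<comment> \<open>Solving for \<open>v\<close> gives a vector of U minus one of the point, the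
        form used in \<open>S\<close>.\<close>
      then have "v = emb (- inverse k) *s (x - emb k *s v) - (- (inverse (emb k))) *s x"
        by (simp add: scale_right_diff_distrib hom_distribs)
      moreover have "emb (- inverse k) *s (x - emb k *s v) \<in> ?U" using k by (rule sub.span_scale)
      moreover have "(- (inverse (emb k))) *s x \<in> span {w}" using xs(2) by (rule span_scale)
      ultimately have "v \<in> S (span {w})"
        unfolding S_def by (metis (mono_tags, lifting) SigmaI case_prod_conv image_eqI)
      then show False using v(2) True by blast
    qed
    then have "sub.span (insert v B) \<inter> span {w} \<subseteq> ?U \<inter> span {w}" by auto
    then have "card (sub.span (insert v B) \<inter> span {w}) \<le> card (?U \<inter> span {w})"
      by (intro card_mono) auto
    also have "\<dots> \<le> ?q ^ Suc t" using w \<open>w \<noteq> 0\<close> unfolding weight_le_def by blast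
    finally show ?thesis .
  next
    case False
    then have "card (?U \<inter> span {w}) \<le> ?q ^ t" using that by (auto simp: heavy_points_def)
    then have "?q * card (?U \<inter> span {w}) \<le> ?q ^ Suc t" unfolding power_Suc by (rule mult_le_mono2)
    moreover have "card (sub.span (insert v B) \<inter> span {w}) \<le> ?q * card (?U \<inter> span {w})"
      by (rule sub.card_Int_span_insert_le) (auto intro: sub_subspace)
    ultimately show ?thesis by (rule order_trans[rotated])
  qed
  then show ?thesis using v(1) by (auto simp: weight_le_def)
qed

text \<open>For \<open>t = 0\<close> the heavy points are those meeting U nontrivially. Each holds a
  nonzero vector of U and distinct points share none, so there are at most q^d of them; this is
  within q^m for every step starting at d \<le> m.\<close>

lemma exists_scattered:
  assumes dims: "CARD('b) = CARD('a) ^ m" "CARD('v) = CARD('b) ^ 3" and "0 < m" and "d \<le> Suc m"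
  shows "\<exists>B. sub.independent B \<and> card B = d \<and> weight_le (sub.span B) 1"
  using \<open>d \<le> Suc m\<close>
proof (induction d)
  case 0
  have "card ({0} \<inter> span {v}) \<le> CARD('a) ^ 1" for v
  proof -
    have "card ({0} \<inter> span {v}) \<le> card {0 :: 'v}" by (rule card_mono) auto
    also have "\<dots> = card {0 :: 'a}" by simp
    also have "\<dots> \<le> CARD('a)" by (rule card_mono) auto
    finally show ?thesis by simp
  qed
  then show ?case by (intro exI[of _ "{}"]) (auto simp: weight_le_def sub.independent_empty)
next
  case (Suc d)
  then obtain B where B: "sub.independent B" "card B = d" "weight_le (sub.span B) 1" by auto
  let ?q = "CARD('a)"
  have c: "card (sub.span B) = ?q ^ d" using sub.card_span[of B] B by simp
  have "card (heavy_points (sub.span B) 0) \<le> ?q ^ m"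
  proof (rule card_heavy_points_le[where U' = "{0}" and k = 1])
    fix P assume "P \<in> heavy_points (sub.span B) 0"
    then show "1 \<le> card (sub.span B \<inter> P - {0})"
      by (auto simp: heavy_points_def sub.span_zero span_zero)
  next
    have "card (sub.span B - {0}) \<le> ?q ^ d" using c by (metis card_mono finite Diff_subset)
    also have "\<dots> \<le> ?q ^ m" using Suc.prems by (intro power_increasing) (simp_all add: Suc_le_eq)
    finally show "card (sub.span B - {0}) \<le> ?q ^ m * 1" by simp
  qed auto
  then obtain v where "v \<notin> sub.span B" "weight_le (sub.span (insert v B)) 1"
    using exists_extension_same_weight[OF dims c, of 0] B Suc.prems \<open>0 < m\<close> by auto
  moreover from this have "v \<notin> B" using sub.span_base by blast
  ultimately show ?case using B
    by (intro exI[of _ "insert v B"]) (simp add: sub.independent_insert)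
qed

text \<open>A point of weight 2 has at least \<open>q\<^sup>2 - q\<close> vectors outside the scattered subspace of
  dimension \<open>m + 1\<close>, which bounds the number of such points by \<open>q ^ m\<close>. The bound from counting
  all nonzero vectors would be slightly too weak.\<close>

lemma exists_weight_2_dim_plus_3:
  assumes dims: "CARD('b) = CARD('a) ^ m" "CARD('v) = CARD('b) ^ 3" and "1 < m"
  shows "\<exists>B. sub.independent B \<and> card B = m + 3 \<and> weight_le (sub.span B) 2"
proof -
  let ?q = "CARD('a)"
  have q: "1 < ?q" using card_mono[of UNIV "{0, 1 :: 'a}"] by simp
  obtain B where B: "sub.independent B" "card B = Suc m" "weight_le (sub.span B) 1"
    using exists_scattered[OF dims, of "Suc m"] \<open>1 < m\<close> by auto
  let ?U = "sub.span B"
  have c: "card ?U = ?q ^ Suc m" using sub.card_span[of B] B by simp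
  have V: "CARD('v) = ?q ^ (3 * m)" using dims by (simp add: power_mult[symmetric] mult.commute)
  have "card ?U < CARD('v)"
    unfolding c V using \<open>1 < m\<close> q by (intro power_strict_increasing) auto
  then obtain v where v: "v \<notin> ?U" by (metis UNIV_eq_I less_irrefl)
  define B' where "B' = insert v B"
  have vB: "v \<notin> B" using v sub.span_base by blast
  have B': "sub.independent B'" "card B' = Suc (Suc m)"
    using B v vB by (simp_all add: B'_def sub.independent_insert)
  have w: "weight_le (sub.span B') (Suc 1)"
    unfolding B'_def by (rule weight_le_span_insert_Suc) (rule B)
  have c': "card (sub.span B') = ?q ^ Suc (Suc m)" using sub.card_span[of B'] B' by simp
  have sub: "?U \<subseteq> sub.span B'" unfolding B'_def by (rule sub.span_mono) auto
  have q2: "?q < ?q\<^sup>2" using q by (simp add: power2_eq_square)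
  have "card (heavy_points (sub.span B') 1) \<le> ?q ^ m"
  proof (rule card_heavy_points_le[where U' = ?U and k = "?q\<^sup>2 - ?q"])
    fix P assume "P \<in> heavy_points (sub.span B') 1"
    then obtain u where u: "u \<noteq> 0" "P = span {u}" "?q ^ 1 < card (sub.span B' \<inter> P)"
      by (auto simp: heavy_points_def)
    have "?q ^ Suc 1 \<le> card (sub.span B' \<inter> P)"
      using u by (intro sub.card_subspace_gt_power) (auto intro: sub.subspace_inter sub_subspace)
    moreover have "card (?U \<inter> P) \<le> ?q" using B(3) u by (simp add: weight_le_def)
    moreover have "card (sub.span B' \<inter> P) - card (?U \<inter> P) \<le> card (sub.span B' \<inter> P - ?U \<inter> P)"
      by (rule diff_card_le_card_Diff) simp
    moreover have "sub.span B' \<inter> P - ?U \<inter> P = sub.span B' \<inter> P - ?U" by auto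
    ultimately show "?q\<^sup>2 - ?q \<le> card (sub.span B' \<inter> P - ?U)" by (simp add: power2_eq_square)
  next
    \<comment> \<open>This difference equals \<open>?q ^ m * (?q\<^sup>2 - ?q)\<close>, so the count
      meets the allowed \<open>?q ^ m\<close> with nothing to spare.\<close>
    have "card (sub.span B' - ?U) = ?q ^ Suc (Suc m) - ?q ^ Suc m"
      using c c' sub by (simp add: card_Diff_subset)
    then show "card (sub.span B' - ?U) \<le> ?q ^ m * (?q\<^sup>2 - ?q)"
      by (simp add: diff_mult_distrib2 power2_eq_square algebra_simps)
  qed (use q2 sub.span_zero in auto)
  \<comment> \<open>Dimension m + 2 is the largest that the extension lemma admits for
    \<open>t = 1\<close>, and m + 2 < 3m follows from \<open>1 < m\<close>.\<close>
  then obtain v' where v': "v' \<notin> sub.span B'" "weight_le (sub.span (insert v' B')) (Suc 1)"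
    using exists_extension_same_weight[OF dims c', of 1] w \<open>1 < m\<close> by auto
  moreover from v' have "v' \<notin> B'" using sub.span_base by blast
  ultimately show ?thesis using B'
    by (intro exI[of _ "insert v' B'"]) (simp add: sub.independent_insert numeral_2_eq_2)
qed

end

section \<open>Linear algebra in dimension three\<close>

text \<open>Triples model F^3 because componentwise addition makes them a finite abelian group type,
  as the locale demands.\<close>

definition scale3 :: "'b::field \<Rightarrow> 'b \<times> 'b \<times> 'b \<Rightarrow> 'b \<times> 'b \<times> 'b" where
  "scale3 c = (\<lambda>(x, y, z). (c * x, c * y, c * z))"

definition dot3 :: "'b::field \<times> 'b \<times> 'b \<Rightarrow> 'b \<times> 'b \<times> 'b \<Rightarrow> 'b" where
  "dot3 = (\<lambda>(a, b, c) (x, y, z). a * x + b * y + c * z)"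

definition cross3 :: "'b::field \<times> 'b \<times> 'b \<Rightarrow> 'b \<times> 'b \<times> 'b \<Rightarrow> 'b \<times> 'b \<times> 'b" where
  "cross3 = (\<lambda>(a, b, c) (x, y, z). (b * z - c * y, c * x - a * z, a * y - b * x))"

lemma vector_space_scale3: "vector_space scale3"
  by unfold_locales (auto simp: scale3_def algebra_simps)

lemma dot3_zero_right [simp]: "dot3 a 0 = 0"
  by (simp add: dot3_def zero_prod_def split: prod.splits)

lemma dot3_diff_right: "dot3 a (x - y) = dot3 a x - dot3 a y"
  by (simp add: dot3_def algebra_simps split: prod.splits)

lemma dot3_add_right: "dot3 a (x + y) = dot3 a x + dot3 a y"
  by (simp add: dot3_def algebra_simps split: prod.splits)

lemma dot3_scale3_right: "dot3 a (scale3 c x) = c * dot3 a x"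
  by (simp add: dot3_def scale3_def algebra_simps split: prod.splits)

lemma dot3_sum_scale3_right:
  "dot3 a (\<Sum>i\<in>S. scale3 (c i) (u i)) = (\<Sum>i\<in>S. c i * dot3 a (u i))"
  by (induction S rule: infinite_finite_induct) (simp_all add: dot3_add_right dot3_scale3_right)

lemma dot3_scale3_left: "dot3 (scale3 c a) x = c * dot3 a x"
  by (simp add: dot3_def scale3_def algebra_simps split: prod.splits)

lemma dot3_eq_0_imp_0: "(\<And>a. dot3 a x = 0) \<Longrightarrow> x = 0"
proof -
  assume "\<And>a. dot3 a x = 0"
  from this[of "(1, 0, 0)"] this[of "(0, 1, 0)"] this[of "(0, 0, 1)"] show ?thesis
    by (simp add: dot3_def zero_prod_def split: prod.splits)
qed

lemma cross3_eq_0_imp_scale3: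
  fixes v w :: "'b::field \<times> 'b \<times> 'b"
  assumes "v \<noteq> 0" "cross3 v w = 0"
  shows "\<exists>c. w = scale3 c v"
proof -
  obtain a b c x y z where v: "v = (a, b, c)" and w: "w = (x, y, z)" by (metis prod_cases3)
  have e: "b * z = c * y" "c * x = a * z" "a * y = b * x"
    using assms(2) by (simp_all add: v w cross3_def zero_prod_def)
  consider "a \<noteq> 0" | "b \<noteq> 0" | "c \<noteq> 0" using assms(1) by (auto simp: v zero_prod_def)
  then show ?thesis
  proof cases
    case 1
    then show ?thesis
      using e by (intro exI[of _ "x / a"]) (simp add: v w scale3_def field_simps)
  next
    case 2
    then show ?thesis
      using e by (intro exI[of _ "y / b"]) (simp add: v w scale3_def field_simps)
  next
    case 3
    then show ?thesis
      using e by (intro exI[of _ "z / c"]) (simp add: v w scale3_def field_simps)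
  qed
qed

text \<open>By the triple product identity. It makes \<open>a\<close> a multiple of
  \<open>cross3 v w\<close> whenever the latter is nonzero.\<close>

lemma cross3_cross3_eq_0:
  assumes "dot3 a v = 0" "dot3 a w = 0"
  shows "cross3 (cross3 v w) a = 0"
proof -
  have "cross3 (cross3 v w) a = scale3 (dot3 a v) w - scale3 (dot3 a w) v"
    by (simp add: cross3_def dot3_def scale3_def algebra_simps split: prod.splits)
  then show ?thesis using assms by (simp add: scale3_def zero_prod_def split: prod.splits)
qed

text \<open>The hyperplane \<open>a\<^sup>\<bottom>\<close> contains more than \<open>k\<close> vectors of \<open>U\<close>, hence two independent ones,
  and these determine \<open>a\<close> up to a scalar.\<close>

lemma orthogonal_subset_imp_scale3_nonzero:
  fixes U :: "('b::{field,finite} \<times> 'b \<times> 'b) set"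
  assumes U: "0 \<in> U" "\<And>x y. x \<in> U \<Longrightarrow> y \<in> U \<Longrightarrow> x - y \<in> U" "CARD('b) * k < card U"
    and pts: "\<And>v. v \<noteq> 0 \<Longrightarrow> card (U \<inter> range (\<lambda>c. scale3 c v)) \<le> k"
    and "a \<noteq> 0" and a': "\<And>x. x \<in> U \<Longrightarrow> dot3 a x = 0 \<Longrightarrow> dot3 a' x = 0"
  shows "\<exists>c. a' = scale3 c a"
proof -
  let ?K = "{x \<in> U. dot3 a x = 0}"
  \<comment> \<open>\<open>dot3 a\<close> takes at most |F| values on \<open>U\<close>, so its
    kernel there has more than \<open>k\<close> vectors.\<close>
  have "card U = card (dot3 a ` U) * card ?K"
    using U by (intro card_eq_image_times_kernel) (auto simp: dot3_diff_right)
  also have "\<dots> \<le> CARD('b) * card ?K" by (intro mult_le_mono1 card_mono) auto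
  finally have K: "k < card ?K" using U(3) by (meson le_trans mult_le_mono2 not_le)
  have ex: "\<exists>w\<in>?K. w \<notin> range (\<lambda>c. scale3 c v)" if "v \<noteq> 0" for v
  proof (rule ccontr)
    assume "\<not> ?thesis"
    then have "card ?K \<le> card (U \<inter> range (\<lambda>c. scale3 c v))" by (intro card_mono) auto
    then show False using K pts[OF that] by simp
  qed
  \<comment> \<open>An arbitrary nonzero vector: avoiding its line only serves to make
    \<open>v\<close> nonzero.\<close>
  have "(1, 0, 0) \<noteq> (0 :: 'b \<times> 'b \<times> 'b)" by (simp add: zero_prod_def)
  from ex[OF this] obtain v where v: "v \<in> ?K" "v \<notin> range (\<lambda>c. scale3 c (1, 0, 0))" by blast
  have "v \<noteq> 0"
  proof
    assume "v = 0"
    then have "v = scale3 0 (1, 0, 0)" by (simp add: scale3_def zero_prod_def)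
    then show False using v(2) by blast
  qed
  from ex[OF this] obtain w where w: "w \<in> ?K" "w \<notin> range (\<lambda>c. scale3 c v)" by blast
  have n: "cross3 v w \<noteq> 0" using cross3_eq_0_imp_scale3[OF \<open>v \<noteq> 0\<close>] w(2) by blast
  obtain \<beta> where \<beta>: "a = scale3 \<beta> (cross3 v w)"
    using cross3_eq_0_imp_scale3[OF n cross3_cross3_eq_0] v w by blast
  obtain \<gamma> where \<gamma>: "a' = scale3 \<gamma> (cross3 v w)"
    using cross3_eq_0_imp_scale3[OF n cross3_cross3_eq_0] v w a' by blast
  have "\<beta> \<noteq> 0" using \<beta> \<open>a \<noteq> 0\<close> by (auto simp: scale3_def zero_prod_def split: prod.splits)
  then have "a' = scale3 (\<gamma> / \<beta>) a"
    unfolding \<beta> \<gamma> by (simp add: scale3_def split: prod.splits)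
  then show ?thesis ..
qed

text \<open>If \<open>a = 0\<close>, then \<open>a'\<close> vanishes on \<open>U\<close> and is
  proportional to every nonzero \<open>e\<close>; two independent choices of \<open>e\<close> force
  \<open>a' = 0\<close>. This case handles the zero codeword.\<close>

lemma orthogonal_subset_imp_scale3:
  fixes U :: "('b::{field,finite} \<times> 'b \<times> 'b) set"
  assumes U: "0 \<in> U" "\<And>x y. x \<in> U \<Longrightarrow> y \<in> U \<Longrightarrow> x - y \<in> U" "CARD('b) * k < card U"
    and pts: "\<And>v. v \<noteq> 0 \<Longrightarrow> card (U \<inter> range (\<lambda>c. scale3 c v)) \<le> k"
    and a': "\<And>x. x \<in> U \<Longrightarrow> dot3 a x = 0 \<Longrightarrow> dot3 a' x = 0"
  shows "\<exists>c. a' = scale3 c a"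
proof (cases "a = 0")
  case False
  then show ?thesis using orthogonal_subset_imp_scale3_nonzero[OF U pts _ a'] by blast
next
  case True
  have "\<And>x. x \<in> U \<Longrightarrow> dot3 a' x = 0"
    using a' True by (simp add: dot3_def zero_prod_def split: prod.splits)
  then have *: "\<exists>c. a' = scale3 c e" if "e \<noteq> 0" for e
    using orthogonal_subset_imp_scale3_nonzero[OF U pts that] by blast
  have "\<exists>c. a' = scale3 c (1, 0, 0)" "\<exists>d. a' = scale3 d (0, 1, 0)"
    using * by (simp_all add: zero_prod_def)
  then obtain c d where "a' = scale3 c (1, 0, 0)" "a' = scale3 d (0, 1, 0)" by blast
  then have "a' = scale3 0 a" by (simp add: scale3_def split: prod.splits)
  then show ?thesis ..
qed

section \<open>Rank supports and codes from systems of points\<close>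

lemma mult_mat_unit_vec:
  fixes A :: "'a::semiring_1 mat"
  assumes "A \<in> carrier_mat n k" "j < k"
  shows "A *\<^sub>v unit_vec k j = col A j"
  using assms by (intro eq_vecI) auto

text \<open>Over a basis \<Gamma> the left sum has coordinates \<open>x \<bullet> col A j\<close>,
  so it vanishes iff \<open>x\<close> is orthogonal to all columns. Supports can thus be compared
  through their annihilators.\<close>

lemma orthogonal_rank_support_iff:
  fixes emb :: "'a::field \<Rightarrow> 'b::{field,finite}"
  assumes hom: "field_hom emb" and x: "x \<in> carrier_vec (dim_vec c)"
  shows "(\<Sum>i<dim_vec c. emb (x $ i) * c $ i) = 0 \<longleftrightarrow> (\<forall>s\<in>rank_support emb c. x \<bullet> s = 0)"
proof -
  interpret field_hom emb by fact
  let ?n = "dim_vec c"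
  obtain \<Gamma> where \<Gamma>: "ordered_basis emb \<Gamma>" using ordered_basis_exists[OF hom] by blast
  define A where "A = expansion emb \<Gamma> c"
  have A: "A \<in> carrier_mat ?n (length \<Gamma>)"
    and cA: "\<And>i. i < ?n \<Longrightarrow> c $ i = (\<Sum>j<length \<Gamma>. emb (A $$ (i, j)) * \<Gamma> ! j)"
    using expansion_works[OF hom \<Gamma>, of c] by (auto simp: A_def is_expansion_def)
  have "(\<Sum>i<?n. emb (x $ i) * c $ i)
      = (\<Sum>i<?n. \<Sum>j<length \<Gamma>. emb (x $ i) * (emb (A $$ (i, j)) * \<Gamma> ! j))"
    by (simp add: cA sum_distrib_left)
  also have "\<dots> = (\<Sum>j<length \<Gamma>. \<Sum>i<?n. emb (x $ i) * (emb (A $$ (i, j)) * \<Gamma> ! j))"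
    by (rule sum.swap)
  also have "\<dots> = (\<Sum>j<length \<Gamma>. emb (x \<bullet> col A j) * \<Gamma> ! j)"
    using A by (intro sum.cong)
      (auto simp: scalar_prod_def hom_distribs sum_distrib_right mult.assoc lessThan_atLeast0)
  finally have s: "(\<Sum>i<?n. emb (x $ i) * c $ i) = (\<Sum>j<length \<Gamma>. emb (x \<bullet> col A j) * \<Gamma> ! j)" .
  have "(\<Sum>i<?n. emb (x $ i) * c $ i) = 0 \<longleftrightarrow> (\<forall>j<length \<Gamma>. x \<bullet> col A j = 0)"
  proof
    assume "(\<Sum>i<?n. emb (x $ i) * c $ i) = 0"
    then have "(\<Sum>j<length \<Gamma>. emb (x \<bullet> col A j) * \<Gamma> ! j) = (\<Sum>j<length \<Gamma>. emb 0 * \<Gamma> ! j)"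
      using s by simp
    from ordered_basis_unique_coords(2)[OF hom \<Gamma> this]
    show "\<forall>j<length \<Gamma>. x \<bullet> col A j = 0" by blast
  qed (simp add: s)
  also have "\<dots> \<longleftrightarrow> (\<forall>s\<in>rank_support emb c. x \<bullet> s = 0)"
  proof
    assume 0: "\<forall>j<length \<Gamma>. x \<bullet> col A j = 0"
    have "A\<^sup>T *\<^sub>v x = 0\<^sub>v (length \<Gamma>)"
      using 0 A x by (intro eq_vecI) (auto simp: comm_scalar_prod[of x ?n])
    then have "x \<bullet> (A *\<^sub>v z) = 0" if "z \<in> carrier_vec (length \<Gamma>)" for z
      using transpose_vec_mult_scalar[OF A that x] that by simp
    then show "\<forall>s\<in>rank_support emb c. x \<bullet> s = 0"
      unfolding rank_support_eq[OF hom \<Gamma>] A_def[symmetric] vec_space.col_space_eq[OF A]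
      using A by auto
  next
    assume 0: "\<forall>s\<in>rank_support emb c. x \<bullet> s = 0"
    have "col A j \<in> rank_support emb c" if "j < length \<Gamma>" for j
      unfolding rank_support_eq[OF hom \<Gamma>] A_def[symmetric] vec_space.col_space_eq[OF A]
      using A that mult_mat_unit_vec[OF A that]
      by (auto intro!: bexI[of _ "unit_vec (length \<Gamma>) j"])
    then show "\<forall>j<length \<Gamma>. x \<bullet> col A j = 0" using 0 by blast
  qed
  finally show ?thesis .
qed

lemma rank_support_subset_imp_annihilator_subset:
  fixes emb :: "'a::field \<Rightarrow> 'b::{field,finite}"
  assumes hom: "field_hom emb" and "rank_support emb c' \<subseteq> rank_support emb c"
    and dims: "dim_vec c = n" "dim_vec c' = n" and "(\<Sum>i<n. emb (x i) * c $ i) = 0"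
  shows "(\<Sum>i<n. emb (x i) * c' $ i) = 0"
  using assms orthogonal_rank_support_iff[OF hom, of "vec n x" c]
    orthogonal_rank_support_iff[OF hom, of "vec n x" c'] by auto

text \<open>Let U be the span of the points over the small field. By \<open>cut\<close>, the
  intersection of U with the hyperplane of \<open>a\<close> determines \<open>a\<close> up to a
  scalar. Coefficients annihilating the codeword of \<open>a\<close> are those whose combination of
  points lies in that hyperplane, so \<open>cut\<close> yields minimality; \<open>indep\<close>
  yields nondegeneracy.\<close>

lemma nondegenerate_minimal_code_of_points:
  fixes emb :: "'a::field \<Rightarrow> 'b::{field,finite}" and u :: "nat \<Rightarrow> 'b \<times> 'b \<times> 'b"
  assumes hom: "field_hom emb"
    and indep: "\<And>x. (\<Sum>i<n. scale3 (emb (x i)) (u i)) = 0 \<Longrightarrow> \<forall>i<n. x i = 0"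
    and cut: "\<And>a a'. (\<And>x. dot3 a (\<Sum>i<n. scale3 (emb (x i)) (u i)) = 0 \<Longrightarrow>
        dot3 a' (\<Sum>i<n. scale3 (emb (x i)) (u i)) = 0) \<Longrightarrow> \<exists>c. a' = scale3 c a"
  defines "C \<equiv> range (\<lambda>a. vec n (\<lambda>i. dot3 a (u i)))"
  shows "vector_code n 3 C" "nondegenerate emb n 3 C" "minimal_code emb C"
proof -
  interpret field_hom emb by fact
  interpret vec_space "TYPE('b)" n .
  \<comment> \<open>The transpose of a generator matrix: its rows are the points, and the code is
    its column space.\<close>
  define G where "G = mat n 3 (\<lambda>(i, r). [fst (u i), fst (snd (u i)), snd (snd (u i))] ! r)"
  have G: "G \<in> carrier_mat n 3" by (simp add: G_def)
  have Gv: "G *\<^sub>v y = vec n (\<lambda>i. dot3 (y $ 0, y $ 1, y $ 2) (u i))" if "y \<in> carrier_vec 3" for y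
    using that by (intro eq_vecI) (auto simp: G_def scalar_prod_def dot3_def
        numeral_3_eq_3 numeral_2_eq_2 algebra_simps split: prod.splits)
  have C: "C = col_space G"
  proof -
    have "vec n (\<lambda>i. dot3 a (u i)) \<in> (*\<^sub>v) G ` carrier_vec 3" for a
    proof -
      obtain a0 a1 a2 where a: "a = (a0, a1, a2)" by (metis prod_cases3)
      let ?y = "vec 3 (\<lambda>i. [a0, a1, a2] ! i)"
      have "G *\<^sub>v ?y = vec n (\<lambda>i. dot3 a (u i))" by (subst Gv) (simp_all add: a)
      then show ?thesis by (metis imageI vec_carrier)
    qed
    then have "C = (*\<^sub>v) G ` carrier_vec 3" using Gv by (auto simp: C_def)
    then show ?thesis unfolding col_space_eq[OF G] using G by auto
  qed
  have ker: "y = 0\<^sub>v 3" if y: "y \<in> carrier_vec 3" "G *\<^sub>v y = 0\<^sub>v n" for y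
  proof -
    have "dot3 (y $ 0, y $ 1, y $ 2) (u i) = 0" if "i < n" for i
      using y that Gv[OF y(1)] by (metis index_vec index_zero_vec(1))
    \<comment> \<open>\<open>cut\<close> for the zero functional: a functional vanishing on all
      points is a multiple of 0. This makes the dimension 3.\<close>
    then have "\<exists>c. (y $ 0, y $ 1, y $ 2) = scale3 c 0"
      by (intro cut) (simp add: dot3_sum_scale3_right)
    then have "y $ 0 = 0" "y $ 1 = 0" "y $ 2 = 0" by (auto simp: scale3_def zero_prod_def)
    then have "y $ i = 0" if "i < 3" for i
      using that by (auto simp: numeral_3_eq_3 numeral_2_eq_2 less_Suc_eq)
    then show ?thesis using y by (intro eq_vecI) auto
  qed
  have dist: "distinct (cols G)"
  proof (rule ccontr)
    assume "\<not> distinct (cols G)"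
    then obtain i j where ij: "i < 3" "j < 3" "i \<noteq> j" "col G i = col G j"
      using G by (auto simp: distinct_conv_nth)
    let ?y = "unit_vec 3 i - unit_vec 3 j :: 'b vec"
    have "G *\<^sub>v ?y = col G i - col G j"
      using ij G by (subst mult_minus_distrib_mat_vec[OF G]) (auto simp: mult_mat_unit_vec)
    also have "\<dots> = 0\<^sub>v n" using ij G by auto
    finally have "?y = 0\<^sub>v 3" by (intro ker) auto
    then have "?y $ i = 0" using ij by simp
    then show False using ij by simp
  qed
  have li: "lin_indpt (set (cols G))" using lin_depE[OF G _ dist] ker by metis
  have cG: "set (cols G) \<subseteq> carrier_vec n" using cols_dim[of G] G by simp
  have CV: "C = span (set (cols G))" using C by (simp add: col_space_def)
  have sub: "VectorSpace.subspace class_ring C V" unfolding CV by (rule span_is_subspace[OF cG])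
  show "vector_code n 3 C"
    using sub lin_indpt_full_rank[OF G dist li] by (simp add: vector_code_def rank_def CV)
  show "nondegenerate emb n 3 C"
    unfolding nondegenerate_def columns_independent_def
  proof (intro allI impI ballI)
    fix H x assume H: "generator_matrix n 3 C H" and x: "x \<in> carrier_vec (dim_col H)"
      and Hx: "H *\<^sub>v map_vec emb x = 0\<^sub>v (dim_row H)"
    have H3: "H \<in> carrier_mat 3 n"
      and b: "vectorspace.basis class_ring (vs C) (set (rows H))"
      using H by (auto simp: generator_matrix_def)
    interpret W: vectorspace class_ring "vs C" by (rule subspace_is_vs[OF sub])
    have rC: "set (rows H) \<subseteq> C" and "W.span (set (rows H)) = C"
      using b by (auto simp: W.basis_def)
    moreover have "submodule class_ring C V" using sub by (simp add: subspace_def)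
    \<comment> \<open>Spans in the substructure \<open>vs C\<close> and in the ambient space
      agree.\<close>
    ultimately have "row_space H = C"
      unfolding row_space_def using span_li_not_depend(1)[OF rC] by simp
    then have C_H: "C = {w \<in> carrier_vec n. \<exists>y\<in>carrier_vec 3. H\<^sup>T *\<^sub>v y = w}"
      using row_space_eq[OF H3] H3 by simp
    have xn: "x \<in> carrier_vec n" using x H3 by simp
    \<comment> \<open>No change of basis is needed: codewords combine the rows of \<open>H\<close>,
      so \<open>x\<close> annihilates them all, and the combination of points with coefficients
      \<open>x\<close> is orthogonal to every \<open>a\<close>.\<close>
    have "c \<bullet> map_vec emb x = 0" if "c \<in> C" for c
    proof -
      obtain y where "y \<in> carrier_vec 3" "c = H\<^sup>T *\<^sub>v y" using \<open>c \<in> C\<close> C_H by auto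
      then show ?thesis
        using transpose_vec_mult_scalar[OF H3, of "map_vec emb x" y] Hx H3 xn by simp
    qed
    then have "dot3 a (\<Sum>i<n. scale3 (emb (x $ i)) (u i)) = 0" for a
      using xn by (force simp: C_def dot3_sum_scale3_right scalar_prod_def lessThan_atLeast0 mult.commute)
    then have "(\<Sum>i<n. scale3 (emb (x $ i)) (u i)) = 0" by (rule dot3_eq_0_imp_0)
    then show "x = 0\<^sub>v (dim_col H)" using indep x H3 by (intro eq_vecI) auto
  qed
  show "minimal_code emb C"
    unfolding minimal_code_def minimal_codeword_def
  proof (intro ballI conjI impI)
    fix c c' assume "c \<in> C" "c' \<in> C" and supp: "rank_support emb c' \<subseteq> rank_support emb c"
    then obtain a a' where c: "c = vec n (\<lambda>i. dot3 a (u i))" and c': "c' = vec n (\<lambda>i. dot3 a' (u i))"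
      by (auto simp: C_def)
    have "\<exists>\<alpha>. a' = scale3 \<alpha> a"
    proof (rule cut)
      fix x assume "dot3 a (\<Sum>i<n. scale3 (emb (x i)) (u i)) = 0"
      then have "(\<Sum>i<n. emb (x i) * c $ i) = 0" by (simp add: dot3_sum_scale3_right c)
      then have "(\<Sum>i<n. emb (x i) * c' $ i) = 0"
        by (rule rank_support_subset_imp_annihilator_subset[OF hom supp, rotated 2])
          (simp_all add: c c')
      then show "dot3 a' (\<Sum>i<n. scale3 (emb (x i)) (u i)) = 0"
        by (simp add: dot3_sum_scale3_right c')
    qed
    then obtain \<alpha> where "a' = scale3 \<alpha> a" by blast
    then show "\<exists>\<alpha>. c' = \<alpha> \<cdot>\<^sub>v c"
      by (intro exI[of _ \<alpha>] eq_vecI) (auto simp: c c' dot3_scale3_left)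
  qed auto
qed

section \<open>The code of a basis of a subspace of dimension m + 3\<close>

theorem theorem7p16:
  fixes q m :: nat
    and emb :: "'a::{field,finite} \<Rightarrow> 'b::{field,finite}"
  assumes "primepow q"
    and "4 \<le> m"
    and "CARD('a) = q"
    and "CARD('b) = q ^ m"
    and "field_hom emb"
  shows "\<exists>C :: 'b vec set.
    vector_code (m + 3) 3 C \<and> nondegenerate emb (m + 3) 3 C \<and> minimal_code emb C"
proof -
  interpret extended_vector_space scale3 emb
    using vector_space_scale3 assms(5) by (rule extended_vector_space.intro)
  have dims: "CARD('b) = CARD('a) ^ m" "CARD('b \<times> 'b \<times> 'b) = CARD('b) ^ 3"
    using assms by (simp_all add: power3_eq_cube)
  obtain B where B: "sub.independent B" "card B = m + 3" "weight_le (sub.span B) 2"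
    using exists_weight_2_dim_plus_3[OF dims] assms(2) by auto
  obtain u where u: "bij_betw u {..<m + 3} B"
    using ex_bij_betw_nat_finite[of B] B(2) by (auto simp: atLeast0LessThan)
  have comb: "(\<Sum>i<m + 3. scale3 (emb (f (u i))) (u i)) = (\<Sum>v\<in>B. scale3 (emb (f v)) v)" for f
    using sum.reindex_bij_betw[OF u, of "\<lambda>v. scale3 (emb (f v)) v"] .
  have span: "sub.span B = range (\<lambda>x. \<Sum>i<m + 3. scale3 (emb (x i)) (u i))"
  proof (intro subset_antisym subsetI)
    fix y assume "y \<in> sub.span B"
    then obtain f where "y = (\<Sum>v\<in>B. scale3 (emb (f v)) v)"
      by (auto simp: sub.span_finite)
    then show "y \<in> range (\<lambda>x. \<Sum>i<m + 3. scale3 (emb (x i)) (u i))" unfolding comb[symmetric]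
      by (rule range_eqI[where x = "\<lambda>i. f (u i)"])
  next
    fix y assume "y \<in> range (\<lambda>x. \<Sum>i<m + 3. scale3 (emb (x i)) (u i))"
    then show "y \<in> sub.span B"
      using bij_betwE[OF u] by (auto intro: sub.span_sum sub.span_scale sub.span_base)
  qed
  have indep: "\<forall>i<m + 3. x i = 0" if "(\<Sum>i<m + 3. scale3 (emb (x i)) (u i)) = 0" for x
  proof -
    \<comment> \<open>Carries the coefficients from indices over to basis vectors.\<close>
    let ?f = "\<lambda>v. x (inv_into {..<m + 3} u v)"
    have f: "?f (u i) = x i" if "i < m + 3" for i
      using u that by (simp add: bij_betw_def inv_into_f_f)
    have 0: "(\<Sum>v\<in>B. scale3 (emb (?f v)) v) = 0"
      unfolding comb[symmetric, of ?f] using that by (simp add: f)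
    have "?f v = 0" if "v \<in> B" for v
      by (rule sub.independentD[OF B(1) finite subset_refl 0 that])
    then show ?thesis using f u by (metis bij_betwE lessThan_iff)
  qed
  have cut: "\<exists>c. a' = scale3 c a"
    if a: "\<And>x. dot3 a (\<Sum>i<m + 3. scale3 (emb (x i)) (u i)) = 0 \<Longrightarrow>
      dot3 a' (\<Sum>i<m + 3. scale3 (emb (x i)) (u i)) = 0" for a a'
  \<comment> \<open>\<open>k = q\<^sup>2\<close> expresses weight at most 2. Dimension m + 3 enters
    through |F| * q^2 = q^(m + 2) < q^(m + 3).\<close>
  proof (rule orthogonal_subset_imp_scale3[where U = "sub.span B" and k = "q\<^sup>2"])
    have "1 < q" using assms(1) by (simp add: primepow_gt_Suc_0)
    moreover have "card (sub.span B) = q ^ (m + 3)"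
      using sub.card_span[of B] B assms(3) by simp
    moreover have "CARD('b) * q\<^sup>2 = q ^ (m + 2)" using assms(4) by (simp only: power_add)
    ultimately show "CARD('b) * q\<^sup>2 < card (sub.span B)" by (simp only: power_strict_increasing)
    show "card (sub.span B \<inter> range (\<lambda>c. scale3 c v)) \<le> q\<^sup>2" if "v \<noteq> 0" for v
      using B(3)[unfolded weight_le_def, rule_format, OF that] assms(3)
      by (simp add: span_singleton)
    show "dot3 a' x = 0" if "x \<in> sub.span B" "dot3 a x = 0" for x
      using that a unfolding span by blast
  qed (auto intro: sub.span_zero sub.span_diff)
  show ?thesis using nondegenerate_minimal_code_of_points[OF assms(5) indep cut] by blast
qed

end
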